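(* Bi-type limits are not in general bi-terminal in the lax-slice of appropriate cones. That is, each of the following holds: (a) there exist $2$-categories $I,\mathcal{A}$, a $2$-functor $F\colon I\to\mathcal{A}$ and a bi-limit $(L,\lambda)$ of $F$ that is not bi-terminal in the lax-slice of $2$-cones over $F$; (b) there exist $2$-categories $I,\mathcal{A}$, a $2$-functor $F\colon I\to\mathcal{A}$ and a pseudo-bi-limit $(L,\lambda)$ of $F$ that is not bi-terminal in the lax-slice of pseudo-cones over $F$; (c) there exist $2$-categories $I,\mathcal{A}$, a $2$-functor $F\colon I\to\mathcal{A}$ and a lax-bi-limit $(L,\lambda)$ of $F$ that is not bi-terminal in the lax-slice of lax-cones over $F$.
   Context: $2$-categories and $2$-functors are strict; $*$ denotes horizontal composition (and whiskering) of $2$-morphisms and juxtaposition denotes vertical composition. A lax-natural transformation $\mu\colon F\Rightarrow G$ between $2$-functors $F,G\colon I\to\mathcal{A}$ consists of morphisms $\mu_i\colon Fi\to Gi$ for $i\in I$ and $2$-morphisms $\mu_f\colon(Gf)\mu_i\Rightarrow\mu_j(Ff)$ for $f\colon i\to j$ in $I$, such that $\mu_{\mathrm{id}_i}=\mathrm{id}_{\mu_i}$, $\mu_{gf}=(\mu_g*Ff)(Gg*\mu_f)$ for composable $f,g$, and $\mu_g(G\alpha*\mu_i)=(\mu_j*F\alpha)\mu_f$ for every $2$-morphism $\alpha\colon f\Rightarrow g$ in $I$. It is pseudo-natural if every $\mu_f$ is invertible, and $2$-natural if every $\mu_f$ is an identity. A modification $\varphi\colon\mu\to\nu$ consists of $2$-morphisms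 $\varphi_i\colon\mu_i\Rightarrow\nu_i$ with $\nu_f(Gf*\varphi_i)=(\varphi_j*Ff)\mu_f$ for every $f\colon i\to j$. $[I,\mathcal{A}]$, $\mathrm{Ps}[I,\mathcal{A}]$, $\mathrm{Lax}[I,\mathcal{A}]$ are the $2$-categories of $2$-functors $I\to\mathcal{A}$, with $2$-natural, pseudo-natural, lax-natural transformations respectively, and modifications. $\Delta X$ is the constant $2$-functor at $X$. A $2$-cone (resp. pseudo-cone, lax-cone) over $F$ is a $2$-natural (resp. pseudo-natural, lax-natural) transformation $\Delta X\Rightarrow F$. A bi-limit (resp. pseudo-bi-limit, lax-bi-limit) of $F$ is an object $L\in\mathcal{A}$ with a $2$-cone (resp. pseudo-cone, lax-cone) $\lambda\colon\Delta L\Rightarrow F$ such that for each $X\in\mathcal{A}$ the functor $\lambda_*\circ\Delta$ from $\mathcal{A}(X,L)$ to $[I,\mathcal{A}](\Delta X,F)$ (resp. $\mathrm{Ps}[I,\mathcal{A}](\Delta X,F)$, $\mathrm{Lax}[I,\mathcal{A}](\Delta X,F)$), given by post-composition with $\lambda$, is an equivalence of categories. The lax-slice of $2$-cones (resp. pseudo-cones, lax-cones) over $F$ is the $2$-category whose objects are pairs $(X,\mu)$ with $\mu\colon\Delta X\Rightarrow F$ a cone of the given type; morphisms $(X,\mu)\to(Y,\nu)$ are pairs $(f,\varphi)$ of a morphism $f\colon X\to Y$ in $\mathcal{A}$ and a modification $\varphi\colon\nu\Delta f\to\mu$; $2$-morphisms $(f,\varphi)\Rightarrow(g,\psi)$ are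 $2$-morphisms $\alpha\colon f\Rightarrow g$ in $\mathcal{A}$ with $\psi(\nu*\Delta\alpha)=\varphi$. An object $L$ of a $2$-category $\mathcal{B}$ is bi-terminal if for all $X\in\mathcal{B}$ there is an equivalence of categories $\mathcal{B}(X,L)\simeq\mathbb{1}$, where $\mathbb{1}$ is the terminal category. *)

theory Defs
  imports "HOL-Library.FuncSet"
begin

section \<open>Categories and equivalences of categories\<close>

record ('o, 'a) cat =
  obs :: "'o set"
  ars :: "'a set"
  src :: "'a \<Rightarrow> 'o"
  tgt :: "'a \<Rightarrow> 'o"
  ident :: "'o \<Rightarrow> 'a"
  cmp :: "'a \<Rightarrow> 'a \<Rightarrow> 'a"  (infixl "\<diamondop>\<index>" 65)

locale category =
  fixes C :: "('o, 'a) cat" (structure)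
  assumes src_tgt: "f \<in> ars C \<Longrightarrow> src C f \<in> obs C \<and> tgt C f \<in> obs C"
    and ident: "x \<in> obs C \<Longrightarrow>
      ident C x \<in> ars C \<and> src C (ident C x) = x \<and> tgt C (ident C x) = x"
    and cmp: "f \<in> ars C \<Longrightarrow> g \<in> ars C \<Longrightarrow> tgt C f = src C g \<Longrightarrow>
      g \<diamondop> f \<in> ars C \<and> src C (g \<diamondop> f) = src C f \<and> tgt C (g \<diamondop> f) = tgt C g"
    and cmp_ident: "f \<in> ars C \<Longrightarrow> f \<diamondop> ident C (src C f) = f \<and> ident C (tgt C f) \<diamondop> f = f"
    and cmp_assoc: "f \<in> ars C \<Longrightarrow> g \<in> ars C \<Longrightarrow> h \<in> ars C \<Longrightarrow>
      tgt C f = src C g \<Longrightarrow> tgt C g = src C h \<Longrightarrow> h \<diamondop> g \<diamondop> f = h \<diamondop> (g \<diamondop> f)"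

text \<open>A functor is a pair of its action on objects and its action on arrows.\<close>

type_synonym ('o, 'a, 'p, 'b) func = "('o \<Rightarrow> 'p) \<times> ('a \<Rightarrow> 'b)"

definition is_functor :: "('o, 'a) cat \<Rightarrow> ('p, 'b) cat \<Rightarrow> ('o, 'a, 'p, 'b) func \<Rightarrow> bool" where
  "is_functor C D F \<longleftrightarrow>
    (\<forall>x\<in>obs C. fst F x \<in> obs D) \<and>
    (\<forall>f\<in>ars C. snd F f \<in> ars D \<and>
      src D (snd F f) = fst F (src C f) \<and> tgt D (snd F f) = fst F (tgt C f)) \<and>
    (\<forall>x\<in>obs C. snd F (ident C x) = ident D (fst F x)) \<and>
    (\<forall>f\<in>ars C. \<forall>g\<in>ars C. tgt C f = src C g \<longrightarrow>
      snd F (g \<diamondop>\<^bsub>C\<^esub> f) = snd F g \<diamondop>\<^bsub>D\<^esub> snd F f)"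

definition id_func :: "('o, 'a, 'o, 'a) func" where
  "id_func = ((\<lambda>x. x), (\<lambda>f. f))"

definition comp_func ::
  "('p, 'b, 'q, 'c) func \<Rightarrow> ('o, 'a, 'p, 'b) func \<Rightarrow> ('o, 'a, 'q, 'c) func" where
  "comp_func G F = ((\<lambda>x. fst G (fst F x)), (\<lambda>f. snd G (snd F f)))"

definition is_iso :: "('o, 'a) cat \<Rightarrow> 'a \<Rightarrow> bool" where
  "is_iso C f \<longleftrightarrow> f \<in> ars C \<and>
    (\<exists>g\<in>ars C. src C g = tgt C f \<and> tgt C g = src C f \<and>
      g \<diamondop>\<^bsub>C\<^esub> f = ident C (src C f) \<and> f \<diamondop>\<^bsub>C\<^esub> g = ident C (tgt C f))"

definition naturally_isomorphic ::
  "('o, 'a) cat \<Rightarrow> ('p, 'b) cat \<Rightarrow> ('o, 'a, 'p, 'b) func \<Rightarrow> ('o, 'a, 'p, 'b) func \<Rightarrow> bool" where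
  "naturally_isomorphic C D F G \<longleftrightarrow>
    (\<exists>\<eta>. (\<forall>x\<in>obs C. is_iso D (\<eta> x) \<and> src D (\<eta> x) = fst F x \<and> tgt D (\<eta> x) = fst G x) \<and>
      (\<forall>f\<in>ars C. \<eta> (tgt C f) \<diamondop>\<^bsub>D\<^esub> snd F f = snd G f \<diamondop>\<^bsub>D\<^esub> \<eta> (src C f)))"

definition is_equivalence ::
  "('o, 'a) cat \<Rightarrow> ('p, 'b) cat \<Rightarrow> ('o, 'a, 'p, 'b) func \<Rightarrow> bool" where
  "is_equivalence C D F \<longleftrightarrow> is_functor C D F \<and>
    (\<exists>G. is_functor D C G \<and>
      naturally_isomorphic C C id_func (comp_func G F) \<and>
      naturally_isomorphic D D (comp_func F G) id_func)"

definition equivalent_categories :: "('o, 'a) cat \<Rightarrow> ('p, 'b) cat \<Rightarrow> bool" where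
  "equivalent_categories C D \<longleftrightarrow> (\<exists>F. is_equivalence C D F)"

definition terminal_cat :: "(unit, unit) cat" where
  "terminal_cat = \<lparr>obs = UNIV, ars = UNIV, src = (\<lambda>_. ()), tgt = (\<lambda>_. ()),
    ident = (\<lambda>_. ()), cmp = (\<lambda>_ _. ())\<rparr>"


section \<open>Strict 2-categories\<close>

record ('o, 'm, 'c) two_cat =
  objs :: "'o set"
  mors :: "'m set"
  cells :: "'c set"
  src1 :: "'m \<Rightarrow> 'o"
  tgt1 :: "'m \<Rightarrow> 'o"
  src2 :: "'c \<Rightarrow> 'm"
  tgt2 :: "'c \<Rightarrow> 'm"
  id1 :: "'o \<Rightarrow> 'm"
  id2 :: "'m \<Rightarrow> 'c"
  comp1 :: "'m \<Rightarrow> 'm \<Rightarrow> 'm"  (infixl "\<cdot>\<index>" 75)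
  hcomp :: "'c \<Rightarrow> 'c \<Rightarrow> 'c"  (infixl "\<star>\<index>" 70)
  vcomp :: "'c \<Rightarrow> 'c \<Rightarrow> 'c"  (infixl "\<odot>\<index>" 65)

abbreviation lwhisker :: "('o, 'm, 'c, 'z) two_cat_scheme \<Rightarrow> 'm \<Rightarrow> 'c \<Rightarrow> 'c"
    (infixl "\<rhd>\<index>" 70) where
  "g \<rhd>\<^bsub>A\<^esub> \<alpha> \<equiv> id2 A g \<star>\<^bsub>A\<^esub> \<alpha>"

abbreviation rwhisker :: "('o, 'm, 'c, 'z) two_cat_scheme \<Rightarrow> 'c \<Rightarrow> 'm \<Rightarrow> 'c"
    (infixl "\<lhd>\<index>" 70) where
  "\<alpha> \<lhd>\<^bsub>A\<^esub> f \<equiv> \<alpha> \<star>\<^bsub>A\<^esub> id2 A f"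

locale two_category =
  fixes A :: "('o, 'm, 'c) two_cat" (structure)
  assumes src1_tgt1: "f \<in> mors A \<Longrightarrow> src1 A f \<in> objs A \<and> tgt1 A f \<in> objs A"
    and src2_tgt2: "\<alpha> \<in> cells A \<Longrightarrow> src2 A \<alpha> \<in> mors A \<and> tgt2 A \<alpha> \<in> mors A \<and>
      src1 A (src2 A \<alpha>) = src1 A (tgt2 A \<alpha>) \<and> tgt1 A (src2 A \<alpha>) = tgt1 A (tgt2 A \<alpha>)"
    and id1: "x \<in> objs A \<Longrightarrow>
      id1 A x \<in> mors A \<and> src1 A (id1 A x) = x \<and> tgt1 A (id1 A x) = x"
    and id2: "f \<in> mors A \<Longrightarrow>
      id2 A f \<in> cells A \<and> src2 A (id2 A f) = f \<and> tgt2 A (id2 A f) = f"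
    and comp1: "f \<in> mors A \<Longrightarrow> g \<in> mors A \<Longrightarrow> tgt1 A f = src1 A g \<Longrightarrow>
      g \<cdot> f \<in> mors A \<and> src1 A (g \<cdot> f) = src1 A f \<and> tgt1 A (g \<cdot> f) = tgt1 A g"
    and vcomp: "\<alpha> \<in> cells A \<Longrightarrow> \<beta> \<in> cells A \<Longrightarrow> tgt2 A \<alpha> = src2 A \<beta> \<Longrightarrow>
      \<beta> \<odot> \<alpha> \<in> cells A \<and> src2 A (\<beta> \<odot> \<alpha>) = src2 A \<alpha> \<and> tgt2 A (\<beta> \<odot> \<alpha>) = tgt2 A \<beta>"
    and hcomp: "\<alpha> \<in> cells A \<Longrightarrow> \<beta> \<in> cells A \<Longrightarrow>
      tgt1 A (src2 A \<alpha>) = src1 A (src2 A \<beta>) \<Longrightarrow>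
      \<beta> \<star> \<alpha> \<in> cells A \<and> src2 A (\<beta> \<star> \<alpha>) = src2 A \<beta> \<cdot> src2 A \<alpha> \<and>
      tgt2 A (\<beta> \<star> \<alpha>) = tgt2 A \<beta> \<cdot> tgt2 A \<alpha>"
    and comp1_id1: "f \<in> mors A \<Longrightarrow> f \<cdot> id1 A (src1 A f) = f \<and> id1 A (tgt1 A f) \<cdot> f = f"
    and comp1_assoc: "f \<in> mors A \<Longrightarrow> g \<in> mors A \<Longrightarrow> h \<in> mors A \<Longrightarrow>
      tgt1 A f = src1 A g \<Longrightarrow> tgt1 A g = src1 A h \<Longrightarrow> h \<cdot> g \<cdot> f = h \<cdot> (g \<cdot> f)"
    and vcomp_id2: "\<alpha> \<in> cells A \<Longrightarrow>
      \<alpha> \<odot> id2 A (src2 A \<alpha>) = \<alpha> \<and> id2 A (tgt2 A \<alpha>) \<odot> \<alpha> = \<alpha>"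
    and vcomp_assoc: "\<alpha> \<in> cells A \<Longrightarrow> \<beta> \<in> cells A \<Longrightarrow> \<gamma> \<in> cells A \<Longrightarrow>
      tgt2 A \<alpha> = src2 A \<beta> \<Longrightarrow> tgt2 A \<beta> = src2 A \<gamma> \<Longrightarrow> \<gamma> \<odot> \<beta> \<odot> \<alpha> = \<gamma> \<odot> (\<beta> \<odot> \<alpha>)"
    and hcomp_id1: "\<alpha> \<in> cells A \<Longrightarrow>
      \<alpha> \<lhd> id1 A (src1 A (src2 A \<alpha>)) = \<alpha> \<and> id1 A (tgt1 A (src2 A \<alpha>)) \<rhd> \<alpha> = \<alpha>"
    and hcomp_assoc: "\<alpha> \<in> cells A \<Longrightarrow> \<beta> \<in> cells A \<Longrightarrow> \<gamma> \<in> cells A \<Longrightarrow>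
      tgt1 A (src2 A \<alpha>) = src1 A (src2 A \<beta>) \<Longrightarrow> tgt1 A (src2 A \<beta>) = src1 A (src2 A \<gamma>) \<Longrightarrow>
      \<gamma> \<star> \<beta> \<star> \<alpha> = \<gamma> \<star> (\<beta> \<star> \<alpha>)"
    and hcomp_id2: "f \<in> mors A \<Longrightarrow> g \<in> mors A \<Longrightarrow> tgt1 A f = src1 A g \<Longrightarrow>
      id2 A g \<star> id2 A f = id2 A (g \<cdot> f)"
    and interchange: "\<alpha> \<in> cells A \<Longrightarrow> \<alpha>' \<in> cells A \<Longrightarrow> \<beta> \<in> cells A \<Longrightarrow> \<beta>' \<in> cells A \<Longrightarrow>
      tgt2 A \<alpha> = src2 A \<alpha>' \<Longrightarrow> tgt2 A \<beta> = src2 A \<beta>' \<Longrightarrow>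
      tgt1 A (src2 A \<alpha>) = src1 A (src2 A \<beta>) \<Longrightarrow>
      (\<beta>' \<odot> \<beta>) \<star> (\<alpha>' \<odot> \<alpha>) = (\<beta>' \<star> \<alpha>') \<odot> (\<beta> \<star> \<alpha>)"

definition hom_cat :: "('o, 'm, 'c) two_cat \<Rightarrow> 'o \<Rightarrow> 'o \<Rightarrow> ('m, 'c) cat" where
  "hom_cat A x y =
    \<lparr>obs = {f \<in> mors A. src1 A f = x \<and> tgt1 A f = y},
     ars = {\<alpha> \<in> cells A. src1 A (src2 A \<alpha>) = x \<and> tgt1 A (src2 A \<alpha>) = y},
     src = src2 A, tgt = tgt2 A, ident = id2 A, cmp = vcomp A\<rparr>"

definition invertible :: "('o, 'm, 'c) two_cat \<Rightarrow> 'c \<Rightarrow> bool" where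
  "invertible A \<alpha> \<longleftrightarrow> \<alpha> \<in> cells A \<and>
    (\<exists>\<beta>\<in>cells A. src2 A \<beta> = tgt2 A \<alpha> \<and> tgt2 A \<beta> = src2 A \<alpha> \<and>
      \<beta> \<odot>\<^bsub>A\<^esub> \<alpha> = id2 A (src2 A \<alpha>) \<and> \<alpha> \<odot>\<^bsub>A\<^esub> \<beta> = id2 A (tgt2 A \<alpha>))"

definition bi_terminal :: "('o, 'm, 'c) two_cat \<Rightarrow> 'o \<Rightarrow> bool" where
  "bi_terminal B l \<longleftrightarrow>
    l \<in> objs B \<and> (\<forall>x\<in>objs B. equivalent_categories (hom_cat B x l) terminal_cat)"


section \<open>2-functors, transformations and modifications\<close>

text \<open>
  2-functors, transformations and modifications are required to take the value \<^const>\<open>undefined\<close>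
  outside the domain 2-category, so that equality in HOL is equality of the mathematical objects.
\<close>

record ('o, 'm, 'c, 'p, 'n, 'd) two_func =
  fobj :: "'o \<Rightarrow> 'p"
  fmor :: "'m \<Rightarrow> 'n"
  fcell :: "'c \<Rightarrow> 'd"

record ('o, 'm, 'c, 'p, 'n, 'd) transf =
  tsrc :: "('o, 'm, 'c, 'p, 'n, 'd) two_func"
  ttgt :: "('o, 'm, 'c, 'p, 'n, 'd) two_func"
  tmor :: "'o \<Rightarrow> 'n"
  tcell :: "'m \<Rightarrow> 'd"

record ('o, 'm, 'c, 'p, 'n, 'd) modif =
  msrc :: "('o, 'm, 'c, 'p, 'n, 'd) transf"
  mtgt :: "('o, 'm, 'c, 'p, 'n, 'd) transf"
  mcell :: "'o \<Rightarrow> 'd"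

definition two_functor ::
  "('o, 'm, 'c) two_cat \<Rightarrow> ('p, 'n, 'd) two_cat \<Rightarrow> ('o, 'm, 'c, 'p, 'n, 'd) two_func \<Rightarrow> bool" where
  "two_functor I A F \<longleftrightarrow>
    fobj F \<in> objs I \<rightarrow>\<^sub>E objs A \<and> fmor F \<in> mors I \<rightarrow>\<^sub>E mors A \<and> fcell F \<in> cells I \<rightarrow>\<^sub>E cells A \<and>
    (\<forall>f\<in>mors I. src1 A (fmor F f) = fobj F (src1 I f) \<and>
      tgt1 A (fmor F f) = fobj F (tgt1 I f)) \<and>
    (\<forall>\<alpha>\<in>cells I. src2 A (fcell F \<alpha>) = fmor F (src2 I \<alpha>) \<and>
      tgt2 A (fcell F \<alpha>) = fmor F (tgt2 I \<alpha>)) \<and>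
    (\<forall>i\<in>objs I. fmor F (id1 I i) = id1 A (fobj F i)) \<and>
    (\<forall>f\<in>mors I. fcell F (id2 I f) = id2 A (fmor F f)) \<and>
    (\<forall>f\<in>mors I. \<forall>g\<in>mors I. tgt1 I f = src1 I g \<longrightarrow>
      fmor F (g \<cdot>\<^bsub>I\<^esub> f) = fmor F g \<cdot>\<^bsub>A\<^esub> fmor F f) \<and>
    (\<forall>\<alpha>\<in>cells I. \<forall>\<beta>\<in>cells I. tgt2 I \<alpha> = src2 I \<beta> \<longrightarrow>
      fcell F (\<beta> \<odot>\<^bsub>I\<^esub> \<alpha>) = fcell F \<beta> \<odot>\<^bsub>A\<^esub> fcell F \<alpha>) \<and>
    (\<forall>\<alpha>\<in>cells I. \<forall>\<beta>\<in>cells I. tgt1 I (src2 I \<alpha>) = src1 I (src2 I \<beta>) \<longrightarrow>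
      fcell F (\<beta> \<star>\<^bsub>I\<^esub> \<alpha>) = fcell F \<beta> \<star>\<^bsub>A\<^esub> fcell F \<alpha>)"

definition lax_natural ::
  "('o, 'm, 'c) two_cat \<Rightarrow> ('p, 'n, 'd) two_cat \<Rightarrow> ('o, 'm, 'c, 'p, 'n, 'd) transf \<Rightarrow> bool" where
  "lax_natural I A \<mu> \<longleftrightarrow> (let F = tsrc \<mu>; G = ttgt \<mu> in
    two_functor I A F \<and> two_functor I A G \<and>
    tmor \<mu> \<in> objs I \<rightarrow>\<^sub>E mors A \<and> tcell \<mu> \<in> mors I \<rightarrow>\<^sub>E cells A \<and>
    (\<forall>i\<in>objs I. src1 A (tmor \<mu> i) = fobj F i \<and> tgt1 A (tmor \<mu> i) = fobj G i) \<and>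
    (\<forall>f\<in>mors I.
      src2 A (tcell \<mu> f) = fmor G f \<cdot>\<^bsub>A\<^esub> tmor \<mu> (src1 I f) \<and>
      tgt2 A (tcell \<mu> f) = tmor \<mu> (tgt1 I f) \<cdot>\<^bsub>A\<^esub> fmor F f) \<and>
    (\<forall>i\<in>objs I. tcell \<mu> (id1 I i) = id2 A (tmor \<mu> i)) \<and>
    (\<forall>f\<in>mors I. \<forall>g\<in>mors I. tgt1 I f = src1 I g \<longrightarrow>
      tcell \<mu> (g \<cdot>\<^bsub>I\<^esub> f) =
        (tcell \<mu> g \<lhd>\<^bsub>A\<^esub> fmor F f) \<odot>\<^bsub>A\<^esub> (fmor G g \<rhd>\<^bsub>A\<^esub> tcell \<mu> f)) \<and>
    (\<forall>\<alpha>\<in>cells I.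
      tcell \<mu> (tgt2 I \<alpha>) \<odot>\<^bsub>A\<^esub> (fcell G \<alpha> \<lhd>\<^bsub>A\<^esub> tmor \<mu> (src1 I (src2 I \<alpha>))) =
        (tmor \<mu> (tgt1 I (src2 I \<alpha>)) \<rhd>\<^bsub>A\<^esub> fcell F \<alpha>) \<odot>\<^bsub>A\<^esub> tcell \<mu> (src2 I \<alpha>)))"

definition pseudo_natural ::
  "('o, 'm, 'c) two_cat \<Rightarrow> ('p, 'n, 'd) two_cat \<Rightarrow> ('o, 'm, 'c, 'p, 'n, 'd) transf \<Rightarrow> bool" where
  "pseudo_natural I A \<mu> \<longleftrightarrow> lax_natural I A \<mu> \<and> (\<forall>f\<in>mors I. invertible A (tcell \<mu> f))"

definition two_natural ::
  "('o, 'm, 'c) two_cat \<Rightarrow> ('p, 'n, 'd) two_cat \<Rightarrow> ('o, 'm, 'c, 'p, 'n, 'd) transf \<Rightarrow> bool" where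
  "two_natural I A \<mu> \<longleftrightarrow> lax_natural I A \<mu> \<and>
    (\<forall>f\<in>mors I. \<exists>h\<in>mors A. tcell \<mu> f = id2 A h)"

definition modification ::
  "('o, 'm, 'c) two_cat \<Rightarrow> ('p, 'n, 'd) two_cat \<Rightarrow> ('o, 'm, 'c, 'p, 'n, 'd) modif \<Rightarrow> bool" where
  "modification I A \<phi> \<longleftrightarrow>
    (let \<mu> = msrc \<phi>; \<nu> = mtgt \<phi>; F = tsrc \<mu>; G = ttgt \<mu> in
    lax_natural I A \<mu> \<and> lax_natural I A \<nu> \<and> tsrc \<nu> = F \<and> ttgt \<nu> = G \<and>
    mcell \<phi> \<in> objs I \<rightarrow>\<^sub>E cells A \<and>
    (\<forall>i\<in>objs I. src2 A (mcell \<phi> i) = tmor \<mu> i \<and> tgt2 A (mcell \<phi> i) = tmor \<nu> i) \<and>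
    (\<forall>f\<in>mors I.
      tcell \<nu> f \<odot>\<^bsub>A\<^esub> (fmor G f \<rhd>\<^bsub>A\<^esub> mcell \<phi> (src1 I f)) =
        (mcell \<phi> (tgt1 I f) \<lhd>\<^bsub>A\<^esub> fmor F f) \<odot>\<^bsub>A\<^esub> tcell \<mu> f))"

datatype kind = Strict | Pseudo | Lax

fun transformation :: "kind \<Rightarrow>
  ('o, 'm, 'c) two_cat \<Rightarrow> ('p, 'n, 'd) two_cat \<Rightarrow> ('o, 'm, 'c, 'p, 'n, 'd) transf \<Rightarrow> bool" where
  "transformation Strict = two_natural"
| "transformation Pseudo = pseudo_natural"
| "transformation Lax = lax_natural"


section \<open>The 2-categories of 2-functors\<close>

definition id_transf :: "('o, 'm, 'c) two_cat \<Rightarrow> ('p, 'n, 'd) two_cat \<Rightarrow>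
  ('o, 'm, 'c, 'p, 'n, 'd) two_func \<Rightarrow> ('o, 'm, 'c, 'p, 'n, 'd) transf" where
  "id_transf I A F = \<lparr>tsrc = F, ttgt = F,
    tmor = (\<lambda>i\<in>objs I. id1 A (fobj F i)),
    tcell = (\<lambda>f\<in>mors I. id2 A (fmor F f))\<rparr>"

definition comp_transf :: "('o, 'm, 'c) two_cat \<Rightarrow> ('p, 'n, 'd) two_cat \<Rightarrow>
  ('o, 'm, 'c, 'p, 'n, 'd) transf \<Rightarrow> ('o, 'm, 'c, 'p, 'n, 'd) transf \<Rightarrow>
  ('o, 'm, 'c, 'p, 'n, 'd) transf" where
  "comp_transf I A \<nu> \<mu> = \<lparr>tsrc = tsrc \<mu>, ttgt = ttgt \<nu>,
    tmor = (\<lambda>i\<in>objs I. tmor \<nu> i \<cdot>\<^bsub>A\<^esub> tmor \<mu> i),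
    tcell = (\<lambda>f\<in>mors I.
      (tmor \<nu> (tgt1 I f) \<rhd>\<^bsub>A\<^esub> tcell \<mu> f) \<odot>\<^bsub>A\<^esub> (tcell \<nu> f \<lhd>\<^bsub>A\<^esub> tmor \<mu> (src1 I f)))\<rparr>"

definition functor_two_cat :: "kind \<Rightarrow> ('o, 'm, 'c) two_cat \<Rightarrow> ('p, 'n, 'd) two_cat \<Rightarrow>
  (('o, 'm, 'c, 'p, 'n, 'd) two_func, ('o, 'm, 'c, 'p, 'n, 'd) transf,
   ('o, 'm, 'c, 'p, 'n, 'd) modif) two_cat" where
  "functor_two_cat K I A =
    \<lparr>objs = {F. two_functor I A F},
     mors = {\<mu>. transformation K I A \<mu>},
     cells = {\<phi>. modification I A \<phi> \<and>
       transformation K I A (msrc \<phi>) \<and> transformation K I A (mtgt \<phi>)},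
     src1 = tsrc, tgt1 = ttgt, src2 = msrc, tgt2 = mtgt,
     id1 = id_transf I A,
     id2 = (\<lambda>\<mu>. \<lparr>msrc = \<mu>, mtgt = \<mu>, mcell = (\<lambda>i\<in>objs I. id2 A (tmor \<mu> i))\<rparr>),
     comp1 = comp_transf I A,
     hcomp = (\<lambda>\<psi> \<phi>.
       \<lparr>msrc = comp_transf I A (msrc \<psi>) (msrc \<phi>), mtgt = comp_transf I A (mtgt \<psi>) (mtgt \<phi>),
        mcell = (\<lambda>i\<in>objs I. mcell \<psi> i \<star>\<^bsub>A\<^esub> mcell \<phi> i)\<rparr>),
     vcomp = (\<lambda>\<psi> \<phi>. \<lparr>msrc = msrc \<phi>, mtgt = mtgt \<psi>,
       mcell = (\<lambda>i\<in>objs I. mcell \<psi> i \<odot>\<^bsub>A\<^esub> mcell \<phi> i)\<rparr>)\<rparr>"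

text \<open>The action of the diagonal 2-functor on objects, morphisms and 2-morphisms.\<close>

definition diag_obj :: "('o, 'm, 'c) two_cat \<Rightarrow> ('p, 'n, 'd) two_cat \<Rightarrow> 'p \<Rightarrow>
  ('o, 'm, 'c, 'p, 'n, 'd) two_func" where
  "diag_obj I A x = \<lparr>fobj = (\<lambda>i\<in>objs I. x), fmor = (\<lambda>f\<in>mors I. id1 A x),
    fcell = (\<lambda>\<alpha>\<in>cells I. id2 A (id1 A x))\<rparr>"

definition diag_mor :: "('o, 'm, 'c) two_cat \<Rightarrow> ('p, 'n, 'd) two_cat \<Rightarrow> 'n \<Rightarrow>
  ('o, 'm, 'c, 'p, 'n, 'd) transf" where
  "diag_mor I A f = \<lparr>tsrc = diag_obj I A (src1 A f), ttgt = diag_obj I A (tgt1 A f),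
    tmor = (\<lambda>i\<in>objs I. f), tcell = (\<lambda>k\<in>mors I. id2 A f)\<rparr>"

definition diag_cell :: "('o, 'm, 'c) two_cat \<Rightarrow> ('p, 'n, 'd) two_cat \<Rightarrow> 'd \<Rightarrow>
  ('o, 'm, 'c, 'p, 'n, 'd) modif" where
  "diag_cell I A \<alpha> = \<lparr>msrc = diag_mor I A (src2 A \<alpha>), mtgt = diag_mor I A (tgt2 A \<alpha>),
    mcell = (\<lambda>i\<in>objs I. \<alpha>)\<rparr>"


section \<open>Cones and bi-limits\<close>

definition cone :: "kind \<Rightarrow> ('o, 'm, 'c) two_cat \<Rightarrow> ('p, 'n, 'd) two_cat \<Rightarrow>
  ('o, 'm, 'c, 'p, 'n, 'd) two_func \<Rightarrow> 'p \<Rightarrow> ('o, 'm, 'c, 'p, 'n, 'd) transf \<Rightarrow> bool" where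
  "cone K I A F x \<mu> \<longleftrightarrow>
    transformation K I A \<mu> \<and> tsrc \<mu> = diag_obj I A x \<and> ttgt \<mu> = F"

definition postcomp :: "('o, 'm, 'c) two_cat \<Rightarrow> 'm \<Rightarrow> ('m, 'c, 'm, 'c) func" where
  "postcomp B l = ((\<lambda>f. l \<cdot>\<^bsub>B\<^esub> f), (\<lambda>\<alpha>. l \<rhd>\<^bsub>B\<^esub> \<alpha>))"

text \<open>
  The kinds \<^const>\<open>Strict\<close>, \<^const>\<open>Pseudo\<close> and \<^const>\<open>Lax\<close> give bi-limits, pseudo-bi-limits and
  lax-bi-limits.
\<close>

definition bi_limit :: "kind \<Rightarrow> ('o, 'm, 'c) two_cat \<Rightarrow> ('p, 'n, 'd) two_cat \<Rightarrow>
  ('o, 'm, 'c, 'p, 'n, 'd) two_func \<Rightarrow> 'p \<Rightarrow> ('o, 'm, 'c, 'p, 'n, 'd) transf \<Rightarrow> bool" where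
  "bi_limit K I A F l \<mu> \<longleftrightarrow> l \<in> objs A \<and> cone K I A F l \<mu> \<and>
    (\<forall>x\<in>objs A. is_equivalence
      (hom_cat A x l)
      (hom_cat (functor_two_cat K I A) (diag_obj I A x) F)
      (comp_func (postcomp (functor_two_cat K I A) \<mu>) (diag_mor I A, diag_cell I A)))"


section \<open>The lax-slice of cones\<close>

text \<open>
  The pair of a morphism and a modification does not determine its source and target, nor does a
  2-morphism of the base; both are therefore stored.
\<close>

record ('ob, 'n, 'mo) slice_mor =
  sm_src :: 'ob
  sm_mor :: 'n
  sm_modif :: 'mo
  sm_tgt :: 'ob

record ('sm, 'd) slice_cell =
  sc_src :: 'sm
  sc_cell :: 'd
  sc_tgt :: 'sm

definition lax_slice :: "kind \<Rightarrow> ('o, 'm, 'c) two_cat \<Rightarrow> ('p, 'n, 'd) two_cat \<Rightarrow>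
  ('o, 'm, 'c, 'p, 'n, 'd) two_func \<Rightarrow>
  ('p \<times> ('o, 'm, 'c, 'p, 'n, 'd) transf,
   ('p \<times> ('o, 'm, 'c, 'p, 'n, 'd) transf, 'n, ('o, 'm, 'c, 'p, 'n, 'd) modif) slice_mor,
   (('p \<times> ('o, 'm, 'c, 'p, 'n, 'd) transf, 'n, ('o, 'm, 'c, 'p, 'n, 'd) modif) slice_mor,
    'd) slice_cell) two_cat" where
  "lax_slice K I A F = (let
      B = functor_two_cat K I A;
      Obj = {(x, \<mu>). x \<in> objs A \<and> cone K I A F x \<mu>};
      Mor = {m. sm_src m \<in> Obj \<and> sm_tgt m \<in> Obj \<and>
        sm_mor m \<in> mors A \<and>
        src1 A (sm_mor m) = fst (sm_src m) \<and> tgt1 A (sm_mor m) = fst (sm_tgt m) \<and>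
        sm_modif m \<in> cells B \<and>
        src2 B (sm_modif m) = snd (sm_tgt m) \<cdot>\<^bsub>B\<^esub> diag_mor I A (sm_mor m) \<and>
        tgt2 B (sm_modif m) = snd (sm_src m)};
      Cell = {a. sc_src a \<in> Mor \<and> sc_tgt a \<in> Mor \<and>
        sm_src (sc_src a) = sm_src (sc_tgt a) \<and> sm_tgt (sc_src a) = sm_tgt (sc_tgt a) \<and>
        sc_cell a \<in> cells A \<and>
        src2 A (sc_cell a) = sm_mor (sc_src a) \<and> tgt2 A (sc_cell a) = sm_mor (sc_tgt a) \<and>
        sm_modif (sc_tgt a) \<odot>\<^bsub>B\<^esub> (snd (sm_tgt (sc_src a)) \<rhd>\<^bsub>B\<^esub> diag_cell I A (sc_cell a)) =
          sm_modif (sc_src a)};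
      cmp1 = (\<lambda>n m. \<lparr>sm_src = sm_src m, sm_mor = sm_mor n \<cdot>\<^bsub>A\<^esub> sm_mor m,
        sm_modif = sm_modif m \<odot>\<^bsub>B\<^esub> (sm_modif n \<lhd>\<^bsub>B\<^esub> diag_mor I A (sm_mor m)),
        sm_tgt = sm_tgt n\<rparr>)
    in
    \<lparr>objs = Obj, mors = Mor, cells = Cell,
     src1 = sm_src, tgt1 = sm_tgt, src2 = sc_src, tgt2 = sc_tgt,
     id1 = (\<lambda>p. \<lparr>sm_src = p, sm_mor = id1 A (fst p), sm_modif = id2 B (snd p), sm_tgt = p\<rparr>),
     id2 = (\<lambda>m. \<lparr>sc_src = m, sc_cell = id2 A (sm_mor m), sc_tgt = m\<rparr>),
     comp1 = cmp1,
     hcomp = (\<lambda>b a. \<lparr>sc_src = cmp1 (sc_src b) (sc_src a),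
       sc_cell = sc_cell b \<star>\<^bsub>A\<^esub> sc_cell a, sc_tgt = cmp1 (sc_tgt b) (sc_tgt a)\<rparr>),
     vcomp = (\<lambda>b a. \<lparr>sc_src = sc_src a, sc_cell = sc_cell b \<odot>\<^bsub>A\<^esub> sc_cell a,
       sc_tgt = sc_tgt b\<rparr>)\<rparr>)"

end

theory Submission
  imports Defs
begin

text \<open>
  Over the terminal 2-category all three kinds of cone over an object \<open>y\<close> are just morphisms into
  \<open>y\<close>, so \<open>y\<close> with its identity is a limit of each type.  In the lax-slice, however, the morphisms
  from \<open>m\<close> to the identity form the slice category of 2-morphisms into \<open>m\<close>, which is trivial only
  if all of these are invertible.  A 2-category with one object, one morphism and the
  additive monoid of natural numbers as 2-morphisms therefore serves as a counterexample.
\<close>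

text \<open>\<open>0\<close> serves as the object, the morphism and every identity. Both
  compositions are addition, so interchange amounts to commutativity. \<open>M = {0}\<close> gives
  the terminal 2-category.\<close>

definition double_deloop :: "nat set \<Rightarrow> (nat, nat, nat) two_cat" where
  "double_deloop M = \<lparr>objs = {0}, mors = {0}, cells = M,
    src1 = (\<lambda>_. 0), tgt1 = (\<lambda>_. 0), src2 = (\<lambda>_. 0), tgt2 = (\<lambda>_. 0),
    id1 = (\<lambda>_. 0), id2 = (\<lambda>_. 0), comp1 = (+), hcomp = (+), vcomp = (+)\<rparr>"

lemma double_deloop_simps [simp]:
  "objs (double_deloop M) = {0}" "mors (double_deloop M) = {0}" "cells (double_deloop M) = M"
  "src1 (double_deloop M) f = 0" "tgt1 (double_deloop M) f = 0"
  "src2 (double_deloop M) a = 0" "tgt2 (double_deloop M) a = 0"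
  "id1 (double_deloop M) x = 0" "id2 (double_deloop M) f = 0"
  "comp1 (double_deloop M) g f = g + f"
  "hcomp (double_deloop M) b a = b + a" "vcomp (double_deloop M) b a = b + a"
  by (simp_all add: double_deloop_def)

lemma two_category_double_deloop:
  assumes "0 \<in> M" and "\<And>a b. a \<in> M \<Longrightarrow> b \<in> M \<Longrightarrow> a + b \<in> M"
  shows "two_category (double_deloop M)"
  by unfold_locales (use assms in auto)

abbreviation pt :: "(nat, nat, nat) two_cat" where
  "pt \<equiv> double_deloop {0}"

abbreviation BBN :: "(nat, nat, nat) two_cat" where
  "BBN \<equiv> double_deloop UNIV"

lemma ext_on_zero: "f \<in> {0::nat} \<rightarrow>\<^sub>E S \<Longrightarrow> f 0 = c \<Longrightarrow> f = (\<lambda>i\<in>{0}. c)"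
  by (auto simp: fun_eq_iff restrict_def PiE_def extensional_def)

lemma two_functor_pt_BBN_iff: "two_functor pt BBN F \<longleftrightarrow> F = diag_obj pt BBN 0"
proof
  assume F: "two_functor pt BBN F"
  then have "fobj F = (\<lambda>i\<in>{0}. 0)" "fmor F = (\<lambda>i\<in>{0}. 0)" "fcell F = (\<lambda>i\<in>{0}. 0)"
    unfolding two_functor_def by (auto intro!: ext_on_zero)
  then show "F = diag_obj pt BBN 0"
    by (simp add: diag_obj_def)
qed (auto simp: two_functor_def diag_obj_def)

text \<open>A priori the 2-morphism component could be any natural number, but the only morphism of
  \<open>pt\<close> is an identity, so the unit axiom forces the component to be
  \<open>0\<close>.\<close>

lemma lax_natural_pt_BBN_iff: "lax_natural pt BBN \<mu> \<longleftrightarrow> \<mu> = diag_mor pt BBN 0"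
proof
  assume \<mu>: "lax_natural pt BBN \<mu>"
  then have "tmor \<mu> = (\<lambda>i\<in>{0}. 0)" "tcell \<mu> = (\<lambda>i\<in>{0}. 0)"
    unfolding lax_natural_def Let_def by (auto intro!: ext_on_zero)
  moreover have "tsrc \<mu> = diag_obj pt BBN 0" "ttgt \<mu> = diag_obj pt BBN 0"
    using \<mu> by (auto simp: lax_natural_def Let_def two_functor_pt_BBN_iff)
  ultimately show "\<mu> = diag_mor pt BBN 0"
    by (simp add: diag_mor_def)
next
  have "two_functor pt BBN (diag_obj pt BBN 0)"
    by (simp add: two_functor_pt_BBN_iff)
  then show "\<mu> = diag_mor pt BBN 0 \<Longrightarrow> lax_natural pt BBN \<mu>"
    by (auto simp: lax_natural_def diag_mor_def diag_obj_def)
qed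

text \<open>The forced component is an identity, hence also invertible, so the three kinds coincide
  and the rest of the argument can be uniform in \<open>K\<close>.\<close>

lemma transformation_pt_BBN_iff: "transformation K pt BBN \<mu> \<longleftrightarrow> \<mu> = diag_mor pt BBN 0"
  by (cases K)
    (auto simp: two_natural_def pseudo_natural_def lax_natural_pt_BBN_iff invertible_def diag_mor_def)

lemma diag_mor_pt_simps [simp]:
  "tsrc (diag_mor pt BBN 0) = diag_obj pt BBN 0" "ttgt (diag_mor pt BBN 0) = diag_obj pt BBN 0"
  by (simp_all add: diag_mor_def)

text \<open>A cone determines its apex only through its source 2-functor; injectivity of the
  diagonal recovers it.\<close>

lemma diag_obj_pt_BBN_eq_iff: "diag_obj pt BBN x = diag_obj pt BBN y \<longleftrightarrow> x = y"
proof
  assume "diag_obj pt BBN x = diag_obj pt BBN y"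
  from arg_cong[OF this, of "\<lambda>F. fobj F 0"] show "x = y"
    by (simp add: diag_obj_def)
qed simp

lemma cone_pt_BBN_iff: "cone K pt BBN (diag_obj pt BBN 0) x \<mu> \<longleftrightarrow> x = 0 \<and> \<mu> = diag_mor pt BBN 0"
  by (auto simp: cone_def transformation_pt_BBN_iff diag_obj_pt_BBN_eq_iff)

text \<open>The modification axiom reads \<open>0 + n = n + 0\<close>, so every natural number is
  admissible as the single component.\<close>

lemma modification_pt_BBN_iff: "modification pt BBN \<phi> \<longleftrightarrow> (\<exists>n. \<phi> = diag_cell pt BBN n)"
proof
  assume \<phi>: "modification pt BBN \<phi>"
  then have "mcell \<phi> = (\<lambda>i\<in>{0}. mcell \<phi> 0)"
    unfolding modification_def Let_def by (auto intro!: ext_on_zero)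
  moreover have "msrc \<phi> = diag_mor pt BBN 0" "mtgt \<phi> = diag_mor pt BBN 0"
    using \<phi> by (auto simp: modification_def Let_def lax_natural_pt_BBN_iff)
  ultimately have "\<phi> = diag_cell pt BBN (mcell \<phi> 0)"
    by (simp add: diag_cell_def)
  then show "\<exists>n. \<phi> = diag_cell pt BBN n" ..
next
  have "lax_natural pt BBN (diag_mor pt BBN 0)"
    by (simp add: lax_natural_pt_BBN_iff)
  then show "\<exists>n. \<phi> = diag_cell pt BBN n \<Longrightarrow> modification pt BBN \<phi>"
    by (auto simp: modification_def diag_cell_def diag_mor_def diag_obj_def)
qed

lemma comp_diag_mor [simp]:
  "comp_transf pt BBN (diag_mor pt BBN 0) (diag_mor pt BBN 0) = diag_mor pt BBN 0"
  by (simp add: comp_transf_def diag_mor_def cong: restrict_cong)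

lemma diag_cell_simps [simp]:
  "msrc (diag_cell pt BBN n) = diag_mor pt BBN 0" "mtgt (diag_cell pt BBN n) = diag_mor pt BBN 0"
  "mcell (diag_cell pt BBN n) 0 = n"
  by (simp_all add: diag_cell_def)

lemma functor_two_cat_pt_BBN_simps [simp]:
  "mors (functor_two_cat K pt BBN) = {diag_mor pt BBN 0}"
  "cells (functor_two_cat K pt BBN) = range (diag_cell pt BBN)"
  "src1 (functor_two_cat K pt BBN) = tsrc" "tgt1 (functor_two_cat K pt BBN) = ttgt"
  "src2 (functor_two_cat K pt BBN) = msrc" "tgt2 (functor_two_cat K pt BBN) = mtgt"
  "id2 (functor_two_cat K pt BBN) (diag_mor pt BBN 0) = diag_cell pt BBN 0"
  "comp1 (functor_two_cat K pt BBN) = comp_transf pt BBN"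
  by (auto simp: functor_two_cat_def transformation_pt_BBN_iff modification_pt_BBN_iff)
    (simp add: diag_cell_def)

lemma functor_two_cat_pt_BBN_comp_simps [simp]:
  "hcomp (functor_two_cat K pt BBN) (diag_cell pt BBN m) (diag_cell pt BBN n) =
     diag_cell pt BBN (m + n)"
  "vcomp (functor_two_cat K pt BBN) (diag_cell pt BBN m) (diag_cell pt BBN n) =
     diag_cell pt BBN (m + n)"
  by (simp_all add: functor_two_cat_def) (simp_all add: diag_cell_def cong: restrict_cong)

lemma bi_limit_pt_BBN: "bi_limit K pt BBN (diag_obj pt BBN 0) 0 (diag_mor pt BBN 0)"
proof -
  let ?B = "functor_two_cat K pt BBN"
  let ?C = "hom_cat BBN 0 0"
  let ?D = "hom_cat ?B (diag_obj pt BBN 0) (diag_obj pt BBN 0)"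
  let ?F = "comp_func (postcomp ?B (diag_mor pt BBN 0)) (diag_mor pt BBN, diag_cell pt BBN)"
  \<comment> \<open>Both hom categories are the additive monoid of naturals seen as a one-object
    category, and \<open>?F\<close> sends \<open>n\<close> to \<open>diag_cell pt BBN n\<close>.
    Evaluation at \<open>0\<close> inverts it strictly, so identities serve as both natural
    isomorphisms below.\<close>
  let ?G = "((\<lambda>_. 0, \<lambda>\<phi>. mcell \<phi> 0) :: (_, _, nat, nat) func)"
  note defs = hom_cat_def is_functor_def comp_func_def postcomp_def id_func_def is_iso_def
  have "is_functor ?C ?D ?F" "is_functor ?D ?C ?G"
    by (auto simp: defs)
  moreover have "naturally_isomorphic ?C ?C id_func (comp_func ?G ?F)"
    unfolding naturally_isomorphic_def by (rule exI[of _ "\<lambda>_. 0"]) (auto simp: defs)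
  moreover have "naturally_isomorphic ?D ?D (comp_func ?F ?G) id_func"
    unfolding naturally_isomorphic_def
    by (rule exI[of _ "\<lambda>_. diag_cell pt BBN 0"]) (auto simp: defs)
  ultimately have "is_equivalence ?C ?D ?F"
    unfolding is_equivalence_def by blast
  then show ?thesis
    by (simp add: bi_limit_def cone_pt_BBN_iff)
qed

text \<open>Take for \<open>z\<close> the image of the unique object under the quasi-inverse. The
  unit of the equivalence gives an isomorphism from each \<open>x\<close> to \<open>z\<close>, hence
  arrows both ways.\<close>

lemma equivalent_terminal_cat_imp_arrow:
  assumes "equivalent_categories C terminal_cat"
  obtains z where "z \<in> obs C"
    and "\<And>x. x \<in> obs C \<Longrightarrow> \<exists>f\<in>ars C. src C f = x \<and> tgt C f = z"
    and "\<And>x. x \<in> obs C \<Longrightarrow> \<exists>f\<in>ars C. src C f = z \<and> tgt C f = x"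
proof -
  from assms obtain F G where G: "is_functor terminal_cat C G"
    and nat: "naturally_isomorphic C C id_func (comp_func G F)"
    unfolding equivalent_categories_def is_equivalence_def by blast
  have "fst G () \<in> obs C"
    using G by (auto simp: is_functor_def terminal_cat_def)
  moreover obtain \<eta> where "\<forall>x\<in>obs C. is_iso C (\<eta> x) \<and> src C (\<eta> x) = x \<and> tgt C (\<eta> x) = fst G ()"
    using nat by (auto simp: naturally_isomorphic_def id_func_def comp_func_def)
  ultimately show thesis
    by (intro that[of "fst G ()"]) (auto simp: is_iso_def, metis+)
qed

lemma not_bi_terminal_pt_BBN:
  "\<not> bi_terminal (lax_slice K pt BBN (diag_obj pt BBN 0)) (0, diag_mor pt BBN 0)"
proof
  let ?S = "lax_slice K pt BBN (diag_obj pt BBN 0)"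
  let ?p = "(0::nat, diag_mor pt BBN 0)"
  let ?C = "hom_cat ?S ?p ?p"
  define m where
    "m n = \<lparr>sm_src = ?p, sm_mor = 0::nat, sm_modif = diag_cell pt BBN n, sm_tgt = ?p\<rparr>" for n
  have obs: "m n \<in> obs ?C" for n
    by (auto simp: hom_cat_def lax_slice_def Let_def m_def cone_pt_BBN_iff)
  have obsD: "\<exists>n. x = m n" if "x \<in> obs ?C" for x
    using that by (cases x) (auto simp: hom_cat_def lax_slice_def Let_def m_def)
  \<comment> \<open>The 2-morphism condition of the slice reads \<open>l + sc_cell f = k\<close>;
    since 2-morphisms are naturals, arrows can only lower the index.\<close>
  have ars: "l \<le> k" if "f \<in> ars ?C" "src ?C f = m k" "tgt ?C f = m l" for f k l
  proof -
    have "diag_cell pt BBN (l + sc_cell f) = diag_cell pt BBN k"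
      using that by (auto simp: hom_cat_def lax_slice_def Let_def m_def)
    from arg_cong[OF this, of "\<lambda>\<phi>. mcell \<phi> 0"] show ?thesis
      by simp
  qed
  assume "bi_terminal ?S ?p"
  then have "equivalent_categories ?C terminal_cat"
    by (auto simp: bi_terminal_def)
  then obtain z where z: "z \<in> obs ?C"
    and into: "\<And>x. x \<in> obs ?C \<Longrightarrow> \<exists>f\<in>ars ?C. src ?C f = x \<and> tgt ?C f = z"
    and out: "\<And>x. x \<in> obs ?C \<Longrightarrow> \<exists>f\<in>ars ?C. src ?C f = z \<and> tgt ?C f = x"
    by (rule equivalent_terminal_cat_imp_arrow) blast
  obtain n where n: "z = m n"
    using obsD[OF z] ..
  \<comment> \<open>An arrow from \<open>m 0\<close> to \<open>z\<close> bounds \<open>n\<close>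
    above by \<open>0\<close>, while one from \<open>z\<close> to \<open>m 1\<close> bounds it below
    by \<open>1\<close>.\<close>
  have "n \<le> 0"
    using into[OF obs[of 0]] ars n by blast
  moreover have "1 \<le> n"
    using out[OF obs[of 1]] ars n by blast
  ultimately show False
    by simp
qed

theorem mainTheorem19:
  "(\<exists>(I :: (nat, nat, nat) two_cat) (A :: (nat, nat, nat) two_cat) F l \<mu>.
      two_category I \<and> two_category A \<and> two_functor I A F \<and>
      bi_limit Strict I A F l \<mu> \<and> \<not> bi_terminal (lax_slice Strict I A F) (l, \<mu>)) \<and>
   (\<exists>(I :: (nat, nat, nat) two_cat) (A :: (nat, nat, nat) two_cat) F l \<mu>.
      two_category I \<and> two_category A \<and> two_functor I A F \<and>
      bi_limit Pseudo I A F l \<mu> \<and> \<not> bi_terminal (lax_slice Pseudo I A F) (l, \<mu>)) \<and>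
   (\<exists>(I :: (nat, nat, nat) two_cat) (A :: (nat, nat, nat) two_cat) F l \<mu>.
      two_category I \<and> two_category A \<and> two_functor I A F \<and>
      bi_limit Lax I A F l \<mu> \<and> \<not> bi_terminal (lax_slice Lax I A F) (l, \<mu>))"
proof -
  have "two_category pt" "two_category BBN"
    by (auto intro!: two_category_double_deloop)
  moreover have "two_functor pt BBN (diag_obj pt BBN 0)"
    by (simp add: two_functor_pt_BBN_iff)
  ultimately show ?thesis
    \<comment> \<open>Both facts hold for every \<open>K\<close>, so the same witnesses settle all
      three conjuncts.\<close>
    using bi_limit_pt_BBN not_bi_terminal_pt_BBN by blast
qed

end
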